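(* Let $m\ge 2$, $n=2m$, $q=2^m$, let $\omega$ be a primitive element of $\mathbb{F}_{q^2}$ and $u=\omega^{(q-1)(2^{n-1}-1)}$ (a generator of $\mu_{q+1}$). Let $a_1\in\mathbb{F}_{q^2}$, $a_2\in\mathbb{F}_{q^2}^*$, let $l_1,l_2$ be non-negative integers with $\gcd(l_2,q+1)=1$, let $I\subseteq\mathbb{Z}_q=\{0,\dots,q-1\}$ and $N=\bigcup_{i\in I}u^i\mathbb{F}_q^*$. Define $$f(x)=\begin{cases}{\rm Tr}_1^n(a_1x^{l_1(q-1)}), & x\in N,\\ {\rm Tr}_1^n(a_2x^{l_2(q-1)}), & \text{otherwise}.\end{cases}$$ Then $f$ is bent if and only if $$\sum_{i\in I}\Big((-1)^{{\rm Tr}_1^n(a_1u^{-2il_1})}-(-1)^{{\rm Tr}_1^n(a_2u^{-2il_2})}\Big)=K_m(a_2^{q+1}).$$ Moreover, in that case the dual of $f$ is $$\widetilde f(x)=\begin{cases}{\rm Tr}_1^n(a_1x^{l_1(1-q)}), & x^{q-1}=u^{2i}\text{ for some } i\in I,\\ {\rm Tr}_1^n(a_2x^{l_2(1-q)}), & \text{otherwise},\end{cases}$$ where $x^{l(1-q)}$ denotes $x^{l(q^2-q)}$.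
   Context: ${\rm Tr}_1^k$ is the absolute trace of $\mathbb{F}_{2^k}$, $\mu_e=\{x:x^e=1\}$. $K_m(a)=\sum_{x\in\mathbb{F}_{q}}(-1)^{{\rm Tr}_1^m(ax+x^{q-2})}$ is the Kloosterman sum over $\mathbb{F}_q$. Walsh transform $\widehat f(b)=\sum_x(-1)^{f(x)+{\rm Tr}_1^n(bx)}$; $f$ bent iff $|\widehat f(b)|=2^{n/2}$ for all $b$; dual $\widetilde f$ defined by $\widehat f(b)=2^{n/2}(-1)^{\widetilde f(b)}$. *)

theory Defs
  imports Complex_Main "HOL-Library.Z2" "HOL-Library.Cardinality"
    "HOL-Computational_Algebra.Computational_Algebra"
begin

text \<open>All finite fields in play are subfields of one ambient field \<open>'a\<close> of
  characteristic 2. \<open>GF k\<close> is its subfield \<open>F\<^bsub>2^k\<^esub>\<close> whenever \<open>'a\<close> has one; the lemmas below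
  confirm this for the cases \<open>CARD('a) = 2 ^ k\<close> and \<open>CARD('a) = 2 ^ (2 * k)\<close>.\<close>

definition GF :: "nat \<Rightarrow> 'a::finite_field set" where
  "GF k = {x. x ^ (2 ^ k) = x}"

text \<open>Boolean functions take values in \<open>F\<^sub>2\<close>, rendered as the type \<^typ>\<open>bit\<close>; the trace
  of \<open>x\<close> is the bit whose image in the prime field of \<open>'a\<close> is the usual sum of conjugates.
  It is meaningful for \<open>x \<in> GF k\<close> only.\<close>

definition Tr :: "nat \<Rightarrow> 'a::finite_field \<Rightarrow> bit" where
  "Tr k x = (THE c. of_bit c = (\<Sum>i<k. x ^ (2 ^ i)))"

definition sign :: "bit \<Rightarrow> int" where
  "sign c = (-1) ^ (of_bit c :: nat)"

definition primitive_element :: "'a::finite_field \<Rightarrow> bool" where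
  "primitive_element w \<longleftrightarrow> range (\<lambda>k::nat. w ^ k) = UNIV - {0}"

definition kloosterman :: "nat \<Rightarrow> 'a::finite_field \<Rightarrow> int" where
  "kloosterman m a = (\<Sum>x\<in>GF m. sign (Tr m (a * x + x ^ (2 ^ m - 2))))"

text \<open>In the following three definitions \<open>'a\<close> itself is \<open>F\<^bsub>2^n\<^esub>\<close>.\<close>

definition walsh :: "nat \<Rightarrow> ('a::finite_field \<Rightarrow> bit) \<Rightarrow> 'a \<Rightarrow> int" where
  "walsh n f b = (\<Sum>x\<in>UNIV. sign (f x + Tr n (b * x)))"

definition bent :: "nat \<Rightarrow> ('a::finite_field \<Rightarrow> bit) \<Rightarrow> bool" where
  "bent n f \<longleftrightarrow> (\<forall>b. \<bar>real_of_int (walsh n f b)\<bar> = 2 powr (real n / 2))"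

definition dual :: "nat \<Rightarrow> ('a::finite_field \<Rightarrow> bit) \<Rightarrow> 'a \<Rightarrow> bit" where
  "dual n f b = (THE c. real_of_int (walsh n f b) = 2 powr (real n / 2) * real_of_int (sign c))"

lemma sign_simps [simp]: "sign 0 = 1" "sign 1 = -1"
  by (simp_all add: sign_def)

lemma dual_eqI:
  assumes "real_of_int (walsh n f b) = 2 powr (real n / 2) * real_of_int (sign c)"
  shows "dual n f b = c"
  unfolding dual_def
proof (rule the_equality)
  fix d
  assume "real_of_int (walsh n f b) = 2 powr (real n / 2) * real_of_int (sign d)"
  with assms have "sign c = sign d"
    by simp
  then show "d = c"
    by (cases c; cases d) simp_all
qed (rule assms)

lemma walsh_dual:
  assumes "bent n f"
  shows "real_of_int (walsh n f b) = 2 powr (real n / 2) * real_of_int (sign (dual n f b))"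
proof -
  have "\<exists>c. real_of_int (walsh n f b) = 2 powr (real n / 2) * real_of_int (sign c)"
  proof (cases "walsh n f b \<ge> 0")
    case True
    with assms have "real_of_int (walsh n f b) = 2 powr (real n / 2) * real_of_int (sign 0)"
      by (auto simp: bent_def dest: spec[of _ b])
    then show ?thesis by blast
  next
    case False
    have "\<bar>real_of_int (walsh n f b)\<bar> = 2 powr (real n / 2)"
      using assms by (simp add: bent_def)
    with False have "real_of_int (walsh n f b) = 2 powr (real n / 2) * real_of_int (sign 1)"
      by simp
    then show ?thesis by blast
  qed
  then show ?thesis
    using dual_eqI by metis
qed

lemma CHAR_2:
  assumes "card (UNIV :: 'a::finite_field set) = 2 ^ n"
  shows "CHAR('a) = 2"
proof -
  have "(\<Sum>x\<in>UNIV. x + 1) = (\<Sum>x\<in>UNIV. x :: 'a)"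
    by (rule sum.reindex_bij_witness[of _ "\<lambda>x. x - 1" "\<lambda>x. x + 1"]) auto
  then have "of_nat (2 ^ n) = (0 :: 'a)"
    using assms by (simp add: sum.distrib)
  then have "CHAR('a) dvd 2 ^ n"
    by (simp only: of_nat_eq_0_iff_char_dvd)
  moreover have "prime CHAR('a)"
    by simp
  ultimately have "CHAR('a) dvd 2"
    using prime_dvd_power by blast
  then show ?thesis
    using \<open>prime CHAR('a)\<close> two_is_prime_nat primes_dvd_imp_eq by blast
qed

lemma of_bit_Tr:
  fixes x :: "'a::finite_field"
  assumes "CARD('a) = 2 ^ n" and "x \<in> GF k"
  shows "of_bit (Tr k x) = (\<Sum>i<k. x ^ (2 ^ i))"
proof -
  let ?s = "\<Sum>i<k. x ^ (2 ^ i)"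
  have "?s ^ 2 = (\<Sum>i<k. (x ^ (2 ^ i)) ^ 2)"
    using freshmans_dream_sum[where 'a = 'a and A = "{..<k}" and f = "\<lambda>i. x ^ (2 ^ i)"]
      CHAR_2[OF assms(1)] by simp
  also have "\<dots> = (\<Sum>i<k. x ^ (2 ^ Suc i))"
    by (simp add: mult.commute flip: power_mult)
  also have "\<dots> = ?s"
    using sum.lessThan_Suc_shift[of "\<lambda>i. x ^ (2 ^ i)" k] assms(2)
    by (simp add: GF_def add.commute)
  finally have "?s * (?s - 1) = 0"
    by (simp add: power2_eq_square algebra_simps)
  then have "?s = 0 \<or> ?s = 1"
    by simp
  then have "of_bit 0 = ?s \<or> of_bit 1 = ?s"
    by auto
  then obtain c where c: "of_bit c = ?s"
    by blast
  have "Tr k x = c"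
    unfolding Tr_def
  proof (rule the_equality)
    fix d
    assume "of_bit d = ?s"
    with c show "d = c"
      by (cases c; cases d) simp_all
  qed (rule c)
  with c show ?thesis
    by simp
qed

lemma GF_UNIV:
  assumes "card (UNIV :: 'a::finite_field set) = 2 ^ n"
  shows "GF n = (UNIV :: 'a set)"
  using finite_field_power_card_eq_same[where 'a = 'a] assms by (auto simp: GF_def)

lemma GF_subfield:
  fixes x y :: "'a::finite_field"
  assumes "CARD('a) = 2 ^ n"
  shows "0 \<in> GF k" "1 \<in> GF k" "x \<in> GF k \<Longrightarrow> y \<in> GF k \<Longrightarrow> x + y \<in> GF k"
    "x \<in> GF k \<Longrightarrow> y \<in> GF k \<Longrightarrow> x * y \<in> GF k" "x \<in> GF k \<Longrightarrow> inverse x \<in> GF k"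
  using freshmans_dream'[where 'a = 'a and x = x and y = y and n = k] CHAR_2[OF assms]
  by (auto simp: GF_def power_mult_distrib power_inverse)

lemma card_GF_half:
  assumes "card (UNIV :: 'a::finite_field set) = 2 ^ (2 * m)" and "m > 0"
  shows "card (GF m :: 'a set) = 2 ^ m"
proof (rule antisym)
  let ?q = "2 ^ m :: nat"
  let ?G = "GF m :: 'a set"
  have q: "?q > 1"
    using assms(2) by (intro one_less_power) auto
  define p :: "'a poly" where "p = monom 1 ?q - monom 1 1"
  have "coeff p ?q = 1"
    using q by (simp add: p_def)
  then have "p \<noteq> 0"
    by auto
  have "degree p \<le> ?q"
    unfolding p_def using q
    by (intro degree_diff_le) (auto simp: degree_monom_eq)
  moreover have "?G = {x. poly p x = 0}"
    by (simp add: p_def GF_def poly_monom)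
  ultimately show "card ?G \<le> ?q"
    using card_poly_roots_bound[OF \<open>p \<noteq> 0\<close>] by simp
next
  let ?q = "2 ^ m :: nat"
  let ?G = "GF m :: 'a set"
  have fd: "(x + y) ^ ?q = x ^ ?q + y ^ ?q" for x y :: 'a
    using freshmans_dream'[where 'a = 'a and x = x and y = y and n = m] CHAR_2[OF assms(1)] by simp
  have two: "x + x = 0" for x :: 'a
    using of_nat_CHAR[where 'a = 'a] CHAR_2[OF assms(1)]
    by (metis mult_2 mult_zero_left of_nat_numeral)
  have qq: "(x ^ ?q) ^ ?q = x" for x :: 'a
    using finite_field_power_card_eq_same[of x] assms(1)
    by (simp add: mult_2 power_add power_mult)
  define h where "h = (\<lambda>x::'a. x ^ ?q + x)"
  have "h x \<in> ?G" for x
    by (simp add: h_def GF_def fd qq add.commute)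
  then have rh: "card (range h) \<le> card ?G"
    by (intro card_mono) auto
  have fib: "card (h -` {y}) \<le> card ?G" for y
  proof (cases "h -` {y} = {}")
    case False
    then obtain x0 where x0: "h x0 = y"
      by auto
    have "x + x0 \<in> ?G" if "h x = y" for x
    proof -
      have "h (x + x0) = h x + h x0"
        by (simp add: h_def fd)
      also have "\<dots> = 0"
        using that x0 two by simp
      finally have "(x + x0) ^ ?q + (x + x0) = 0"
        by (simp add: h_def)
      then have "(x + x0) ^ ?q = x + x0"
        using two by (metis add_right_cancel)
      then show ?thesis
        by (simp add: GF_def)
    qed
    then show ?thesis
      by (intro card_inj_on_le[where f = "\<lambda>x. x + x0"]) auto
  qed simp
  have "(?q) ^ 2 = card (\<Union>y\<in>range h. h -` {y})"
  proof -
    have "(\<Union>y\<in>range h. h -` {y}) = UNIV"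
      by auto
    then show ?thesis
      using assms(1) by (simp add: power_mult mult.commute)
  qed
  also have "\<dots> \<le> (\<Sum>y\<in>range h. card (h -` {y}))"
    by (rule card_UN_le) simp
  also have "\<dots> \<le> card (range h) * card ?G"
    using sum_bounded_above[of "range h" "\<lambda>y. card (h -` {y})" "card ?G"] fib by simp
  also have "\<dots> \<le> card ?G ^ 2"
    using rh by (simp add: power2_eq_square)
  finally show "?q \<le> card ?G"
    by (rule power2_le_imp_le) simp
qed

end

theory Submission
  imports Defs
begin

text \<open>Every nonzero \<open>x\<close> is uniquely \<open>u\<^sup>i y\<close> with \<open>i \<le> q\<close> and \<open>y\<close> in the nonzero part of \<open>GF m\<close>, and
  \<open>f x\<close> depends on \<open>i\<close> only, say \<open>f x = g i\<close>. Summing over \<open>y\<close> first, with \<open>S = \<Sum>i\<le>q. (-1)\<^bsup>g i\<^esup>\<close> the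
  Walsh transform is \<open>1 + (q - 1) S\<close> at \<open>0\<close> and \<open>1 - S + q (-1)\<^bsup>g i\<^esup>\<close> at \<open>b \<noteq> 0\<close>, where \<open>i\<close> is the unique
  exponent with \<open>b\<^bsup>q - 1\<^esup> = u\<^bsup>2 i\<^esup>\<close>. As \<open>q \<ge> 4\<close>, bentness amounts to \<open>S = 1\<close>. Finally the sum of
  \<open>(-1)\<^bsup>Tr(a z)\<^esup>\<close> over the \<open>z\<close> with \<open>z\<^bsup>q + 1\<^esup> = 1\<close> is \<open>1 - K\<^sub>m(a\<^bsup>q + 1\<^esup>)\<close>.\<close>

section \<open>Signs, and the order of a primitive element\<close>

lemma sign_add: "sign (a + b) = sign a * sign b"
  by (cases a; cases b) simp_all

lemma abs_sign [simp]: "\<bar>sign a\<bar> = 1"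
  by (cases a) simp_all

lemma Tr_0 [simp]: "Tr k (0 :: 'a::finite_field) = 0"
  unfolding Tr_def
proof (rule the_equality)
  show "of_bit 0 = (\<Sum>i<k. (0 :: 'a) ^ 2 ^ i)"
    by (simp add: power_0_left)
  fix d :: bit
  assume "of_bit d = (\<Sum>i<k. (0 :: 'a) ^ 2 ^ i)"
  then show "d = 0"
    by (cases d) (simp_all add: power_0_left)
qed

text \<open>If \<open>w ^ r = 1\<close> with \<open>0 < r < CARD('a) - 1\<close>, the powers of
  \<open>w\<close> would take at most \<open>r\<close> values, too few to cover all nonzero
  elements. The converse is Fermat's little theorem for finite fields.\<close>

lemma primitive_element_power_eq_1_iff:
  fixes w :: "'a::finite_field"
  assumes "primitive_element w"
  shows "w ^ k = 1 \<longleftrightarrow> (CARD('a) - 1) dvd k"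
proof
  let ?N = "CARD('a) - 1"
  have "1 < CARD('a)"
    using card_mono[of UNIV "{0, 1 :: 'a}"] by simp
  then have N: "?N > 0"
    by simp
  have "w ^ 1 \<in> range (\<lambda>k. w ^ k)"
    by blast
  then have "w \<noteq> 0"
    using assms unfolding primitive_element_def by auto
  have "w ^ CARD('a) = w"
    by (rule finite_field_power_card_eq_same)
  then have "w * w ^ ?N = w * 1"
    using N by (metis mult.right_neutral power_minus_mult mult.commute zero_less_card_finite)
  then have wN: "w ^ ?N = 1"
    using \<open>w \<noteq> 0\<close> by simp
  then show "w ^ k = 1" if "?N dvd k"
    using that by (auto simp: dvd_def power_mult)
  assume "w ^ k = 1"
  define r where "r = k mod ?N"
  have "w ^ k = (w ^ ?N) ^ (k div ?N) * w ^ r"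
    unfolding r_def by (simp flip: power_mult power_add)
  then have wr: "w ^ r = 1"
    using wN \<open>w ^ k = 1\<close> by simp
  have "r < ?N"
    using N by (simp add: r_def)
  have "r = 0"
  proof (rule ccontr)
    assume "r \<noteq> 0"
    have "w ^ j = w ^ (j mod r)" for j
    proof -
      have "w ^ j = (w ^ r) ^ (j div r) * w ^ (j mod r)"
        by (simp flip: power_mult power_add)
      then show ?thesis
        by (simp add: wr)
    qed
    moreover have "j mod r \<in> {..<r}" for j
      using \<open>r \<noteq> 0\<close> by simp
    ultimately have "range (\<lambda>k. w ^ k) \<subseteq> (\<lambda>k. w ^ k) ` {..<r}"
      by blast
    then have "UNIV - {0} \<subseteq> (\<lambda>k. w ^ k) ` {..<r}"
      using assms by (simp add: primitive_element_def)
    then have "card (UNIV - {0 :: 'a}) \<le> card ((\<lambda>k. w ^ k) ` {..<r})"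
      by (intro card_mono) auto
    also have "\<dots> \<le> r"
      using card_image_le[of "{..<r}" "\<lambda>k. w ^ k"] by simp
    finally show False
      using \<open>r < ?N\<close> by (simp add: card_Diff_singleton)
  qed
  then show "?N dvd k"
    by (simp add: r_def mod_eq_0_iff_dvd)
qed

section \<open>The field with \<open>q ^ 2\<close> elements, its subfield \<open>GF m\<close>, and
  an element \<open>u\<close> of exact order \<open>q + 1\<close>\<close>

locale polar_decomposition =
  fixes m q :: nat and u :: "'a::finite_field"
  assumes m_ge_2: "m \<ge> 2"
    and q_def: "q = 2 ^ m"
    and card_UNIV: "CARD('a) = q ^ 2"
    and u_power_eq_1_iff: "u ^ k = 1 \<longleftrightarrow> (q + 1) dvd k"
begin

lemma card': "CARD('a) = 2 ^ (2 * m)"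
  by (simp add: card_UNIV q_def power_mult mult.commute)

lemma m_pos: "m > 0"
  using m_ge_2 by simp

lemma q_ge_4: "q \<ge> 4"
  using power_increasing[OF m_ge_2, of "2 :: nat"] by (simp add: q_def)

lemma q_gt_1: "q > 1"
  using q_ge_4 by simp

lemma q_even: "even q"
  using m_pos by (simp add: q_def)

lemma char_2: "CHAR('a) = 2"
  by (rule CHAR_2[OF card'])

lemma add_self [simp]: "x + x = (0 :: 'a)"
  using of_nat_CHAR[where 'a = 'a] char_2 by (metis mult_2 mult_zero_left of_nat_numeral)

lemma add_eq_0_iff_eq: "x + y = 0 \<longleftrightarrow> x = (y :: 'a)"
  using add_self by (metis add_right_cancel)

lemma power2k_add: "(x + y) ^ (2 ^ k) = x ^ (2 ^ k) + y ^ (2 ^ k :: nat)" for x y :: 'a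
  using freshmans_dream'[where 'a = 'a and x = x and y = y and n = k] char_2 by simp

lemma power_q_q [simp]: "(x ^ q) ^ q = (x :: 'a)"
  using finite_field_power_card_eq_same[of x] card_UNIV by (simp add: power2_eq_square power_mult)

lemma mem_GF: "x \<in> GF m \<longleftrightarrow> x ^ q = (x :: 'a)"
  by (simp add: GF_def q_def)

lemma mem_GF': "x \<in> GF m \<longleftrightarrow> x = 0 \<or> x ^ (q - 1) = (1 :: 'a)"
proof -
  have "x ^ q = x * x ^ (q - 1)"
    using q_gt_1 by (simp flip: power_Suc)
  then show ?thesis
    by (auto simp: mem_GF)
qed

lemma card_GF: "card (GF m :: 'a set) = q"
  using card_GF_half[where 'a = 'a, OF card' m_pos] by (simp add: q_def)

lemma GF_n: "(x :: 'a) \<in> GF (2 * m)"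
  using GF_UNIV[where 'a = 'a, OF card'] by simp

lemmas GF_intros = GF_subfield[OF card', where k = m]

text \<open>This is the relative trace to \<open>GF m\<close>: raising to the power \<open>q\<close>
  swaps the two summands.\<close>

lemma add_power_q_mem_GF: "x + x ^ q \<in> GF m" for x :: 'a
  using power2k_add[of x "x ^ q" m] by (simp add: mem_GF add.commute flip: q_def)

lemma zero_mem_GF [simp]: "(0 :: 'a) \<in> GF m"
  using q_gt_1 by (simp add: mem_GF power_0_left)

lemma card_GF_nonzero: "card (GF m - {0 :: 'a}) = q - 1"
  using card_Diff_singleton[OF zero_mem_GF] by (simp add: card_GF)

section \<open>Traces and additive character sums over \<open>GF m\<close>\<close>

lemma of_bit_add: "of_bit (a + b) = (of_bit a + of_bit b :: 'a)"
  by (cases a; cases b) simp_all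

lemma of_bit_eqD: "of_bit a = (of_bit b :: 'a) \<Longrightarrow> a = b"
  by (cases a; cases b) simp_all

lemma Tr_add:
  fixes x y :: 'a
  assumes "x \<in> GF k" "y \<in> GF k"
  shows "Tr k (x + y) = Tr k x + Tr k y"
proof -
  have "x + y \<in> GF k"
    using GF_subfield(3)[OF card'] assms by blast
  then have "of_bit (Tr k (x + y)) = (of_bit (Tr k x + Tr k y) :: 'a)"
    using assms by (simp only: of_bit_add of_bit_Tr[OF card'] power2k_add sum.distrib)
  then show ?thesis
    by (rule of_bit_eqD)
qed

text \<open>The first \<open>m\<close> conjugates of \<open>x\<close> are paired with the last
  \<open>m\<close>, which are the conjugates of \<open>x ^ q\<close>.\<close>

lemma Tr_transitive: "Tr (2 * m) x = Tr m (x + x ^ q)" for x :: 'a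
proof (rule of_bit_eqD)
  have "(\<Sum>i<2 * m. x ^ 2 ^ i) = (\<Sum>i\<in>{0..<m}. x ^ 2 ^ i) + (\<Sum>i\<in>{0 + m..<m + m}. x ^ 2 ^ i)"
    by (simp add: sum.atLeastLessThan_concat lessThan_atLeast0 mult_2)
  also have "(\<Sum>i\<in>{0 + m..<m + m}. x ^ 2 ^ i) = (\<Sum>i\<in>{0..<m}. (x ^ q) ^ 2 ^ i)"
    unfolding sum.shift_bounds_nat_ivl
    by (simp add: q_def power_add mult.commute flip: power_mult)
  also have "(\<Sum>i\<in>{0..<m}. x ^ 2 ^ i) + (\<Sum>i\<in>{0..<m}. (x ^ q) ^ 2 ^ i) = (\<Sum>i<m. (x + x ^ q) ^ 2 ^ i)"
    by (simp add: power2k_add sum.distrib lessThan_atLeast0)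
  finally show "of_bit (Tr (2 * m) x) = (of_bit (Tr m (x + x ^ q)) :: 'a)"
    by (simp only: of_bit_Tr[OF card'] GF_n add_power_q_mem_GF)
qed

text \<open>The trace is a nonzero polynomial of degree at most \<open>2 ^ (m - 1)\<close>, so it
  cannot vanish at all \<open>q\<close> elements of \<open>GF m\<close>.\<close>

lemma ex_Tr_1: "\<exists>x\<in>GF m. Tr m (x :: 'a) = 1"
proof (rule ccontr)
  assume "\<not> ?thesis"
  then have *: "Tr m x = 0" if "x \<in> GF m" for x :: 'a
    using that by (metis (full_types) bit.exhaust)
  define p :: "'a poly" where "p = (\<Sum>i<m. monom 1 (2 ^ i))"
  have "coeff p 1 = (\<Sum>i<m. if i = 0 then 1 else 0)"
    unfolding p_def coeff_sum by (intro sum.cong) auto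
  also have "\<dots> = 1"
    using m_pos by simp
  finally have "p \<noteq> 0"
    by auto
  have "degree p \<le> 2 ^ (m - 1)"
    unfolding p_def by (intro degree_sum_le) (auto simp: degree_monom_eq)
  have "poly p x = 0" if "x \<in> GF m" for x
    using of_bit_Tr[OF card' that] *[OF that] by (simp add: p_def poly_sum poly_monom)
  then have "card (GF m :: 'a set) \<le> card {x. poly p x = 0}"
    by (intro card_mono) auto
  also have "\<dots> \<le> 2 ^ (m - 1)"
    using card_poly_roots_bound[OF \<open>p \<noteq> 0\<close>] \<open>degree p \<le> _\<close> by simp
  also have "\<dots> < q"
    using m_pos by (simp add: q_def)
  finally show False
    by (simp add: card_GF)
qed

text \<open>Translation by an element of trace 1 permutes \<open>GF m\<close> and flips every sign,
  so the sum equals its own negative.\<close>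

lemma sum_sign_Tr_GF: "(\<Sum>x\<in>GF m. sign (Tr m (x :: 'a))) = 0"
proof -
  obtain t :: 'a where t: "t \<in> GF m" "Tr m t = 1"
    using ex_Tr_1 by blast
  have "(\<Sum>x\<in>GF m. sign (Tr m (x :: 'a))) = (\<Sum>x\<in>GF m. sign (Tr m (x + t)))"
    by (rule sum.reindex_bij_witness[of _ "\<lambda>x. x + t" "\<lambda>x. x + t"])
      (auto simp: add.assoc GF_intros t)
  also have "\<dots> = (\<Sum>x\<in>GF m. - sign (Tr m (x :: 'a)))"
    by (intro sum.cong) (auto simp: Tr_add t sign_add)
  finally show ?thesis
    by (simp add: sum_negf)
qed

text \<open>Orthogonality of characters; the \<open>- 1\<close> removes the term at
  \<open>y = 0\<close>.\<close>

lemma sum_sign_Tr_GF_mult: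
  fixes c :: 'a
  assumes "c \<in> GF m"
  shows "(\<Sum>y\<in>GF m - {0}. sign (Tr m (c * y))) = (if c = 0 then int q else 0) - 1"
proof -
  have "(\<Sum>y\<in>GF m. sign (Tr m (c * y))) = (if c = 0 then int q else 0)"
  proof (cases "c = 0")
    case False
    have "(\<Sum>y\<in>GF m. sign (Tr m (c * y))) = (\<Sum>x\<in>GF m. sign (Tr m (x :: 'a)))"
      by (rule sum.reindex_bij_witness[of _ "\<lambda>x. inverse c * x" "\<lambda>y. c * y"])
        (use False assms in \<open>auto simp: GF_intros simp flip: mult.assoc\<close>)
    then show ?thesis
      using False by (simp add: sum_sign_Tr_GF)
  qed (simp add: card_GF)
  then show ?thesis
    using sum.remove[of "GF m" 0 "\<lambda>y. sign (Tr m (c * y))"] by simp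
qed


section \<open>Kloosterman sums as character sums over a fibre of the norm\<close>

text \<open>On the nonzero elements of \<open>GF m\<close> and on \<open>B\<close>, the map \<open>y \<mapsto> y + A / y\<close> takes values
  in \<open>GF m\<close>, and the roots of \<open>y\<^sup>2 + c y + A\<close> give each \<open>c\<close> at most two preimages, counted in both
  sets. There are \<open>(q - 1) + (q + 1) = 2 q\<close> points altogether, hence exactly two preimages for
  each \<open>c\<close>, and the two character sums cancel.\<close>

lemma kloosterman_eq:
  fixes A :: 'a
  assumes A: "A \<in> GF m" "A \<noteq> 0"
    and B: "\<And>y. y \<in> B \<Longrightarrow> y ^ (q + 1) = A" "card B = q + 1"
  shows "kloosterman m A = 1 - (\<Sum>y\<in>B. sign (Tr (2 * m) y))"
proof -
  define \<phi> where "\<phi> = (\<lambda>y::'a. y + A * inverse y)"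
  define G where "G = GF m - {0 :: 'a}"
  define P where "P = (\<lambda>c. {y \<in> G. \<phi> y = c})"
  define Q where "Q = (\<lambda>c. {y \<in> B. \<phi> y = c})"
  have nz: "y \<noteq> 0" if "y \<in> G \<union> B" for y
    using that B(1)[of y] A(2) by (auto simp: G_def)
  \<comment> \<open>On \<open>B\<close> the norm condition turns \<open>A / y\<close> into
    \<open>y ^ q\<close>, so \<open>\<phi>\<close> becomes the relative trace.\<close>
  have \<phi>_B: "\<phi> y = y + y ^ q" if "y \<in> B" for y
    using B(1)[OF that, symmetric] nz[of y] that by (simp add: \<phi>_def mult.commute)
  have \<phi>_G: "\<phi> ` G \<subseteq> GF m"
    using A GF_intros by (auto simp: \<phi>_def G_def)
  have \<phi>_B': "\<phi> ` B \<subseteq> GF m"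
    using add_power_q_mem_GF by (auto simp: \<phi>_B)
  have \<phi>_eq: "z = y \<or> z = A * inverse y" if "\<phi> y = \<phi> z" "y \<in> G \<union> B" "z \<in> G \<union> B" for y z
  proof -
    have "y \<noteq> 0" "z \<noteq> 0"
      using nz that by auto
    then have "(\<phi> y - \<phi> z) * (y * z) = (y - z) * (y * z - A)"
      unfolding \<phi>_def by (simp add: field_simps)
    then have "y = z \<or> y * z = A"
      using that(1) by simp
    then show ?thesis
      using \<open>y \<noteq> 0\<close> by (auto simp: field_simps)
  qed
  have bound: "card (P c) + card (Q c) \<le> 2" for c
  proof (cases "P c \<union> Q c = {}")
    case False
    then obtain y where y: "y \<in> P c \<union> Q c"
      by blast
    have sub: "P c \<union> Q c \<subseteq> {y, A * inverse y}"
    proof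
      fix z assume "z \<in> P c \<union> Q c"
      with y show "z \<in> {y, A * inverse y}"
        using \<phi>_eq[of y z] by (auto simp: P_def Q_def)
    qed
    show ?thesis
    proof (cases "c = 0")
      case True
      \<comment> \<open>The two candidate roots coincide here: \<open>y\<close> is the square root
        of \<open>A\<close>, which may lie in both sets and is then counted twice.\<close>
      then have "y + A * inverse y = 0"
        using y by (auto simp: P_def Q_def \<phi>_def)
      then have "A * inverse y = y"
        by (simp add: add_eq_0_iff_eq)
      then have "card (P c) \<le> card {y}" "card (Q c) \<le> card {y}"
        using sub by (intro card_mono; simp)+
      then show ?thesis
        by simp
    next
      case False
      \<comment> \<open>A common element would satisfy \<open>z ^ q = z\<close>, making its relative
        trace \<open>c\<close> zero.\<close>
      have "z \<notin> Q c" if "z \<in> P c" for z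
      proof
        assume "z \<in> Q c"
        then have "z \<in> B" "\<phi> z = c"
          by (auto simp: Q_def)
        moreover have "z ^ q = z"
          using that by (auto simp: P_def G_def mem_GF)
        ultimately show False
          using \<phi>_B[of z] False by simp
      qed
      then have "P c \<inter> Q c = {}"
        by blast
      then have "card (P c) + card (Q c) = card (P c \<union> Q c)"
        by (simp add: card_Un_disjoint)
      also have "\<dots> \<le> card {y, A * inverse y}"
        using sub by (intro card_mono) auto
      also have "\<dots> \<le> 2"
        using card_insert_le_m1[of 2 "{A * inverse y}" y] by simp
      finally show ?thesis .
    qed
  qed simp
  have "card G = q - 1"
    by (simp add: G_def card_GF_nonzero)
  moreover have "(\<Sum>c\<in>GF m. card (P c)) = card G" "(\<Sum>c\<in>GF m. card (Q c)) = card B"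
    unfolding P_def Q_def
    using sum.group[OF _ _ \<phi>_G, of "\<lambda>_. 1 :: nat"] sum.group[OF _ _ \<phi>_B', of "\<lambda>_. 1 :: nat"]
    by simp_all
  ultimately have "(\<Sum>c\<in>GF m. card (P c) + card (Q c)) = (\<Sum>c\<in>(GF m :: 'a set). 2)"
    using B(2) q_gt_1 by (simp add: sum.distrib card_GF)
  \<comment> \<open>\<open>bound\<close> makes the truncated subtraction genuine; the defects add up
    to 0, so each of them is 0.\<close>
  then have "(\<Sum>c\<in>(GF m :: 'a set). 2 - (card (P c) + card (Q c))) = 0"
    using sum_subtractf_nat[of "GF m" "\<lambda>c. card (P c) + card (Q c)" "\<lambda>_. 2"] bound by simp
  then have two: "card (P c) + card (Q c) = 2" if "c \<in> GF m" for c
    using bound[of c] that by (simp add: le_antisym)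
  have "(\<Sum>y\<in>G. sign (Tr m (\<phi> y))) + (\<Sum>y\<in>B. sign (Tr m (\<phi> y)))
    = (\<Sum>c\<in>GF m. \<Sum>y\<in>P c. sign (Tr m (\<phi> y))) + (\<Sum>c\<in>GF m. \<Sum>y\<in>Q c. sign (Tr m (\<phi> y)))"
    unfolding P_def Q_def
    using sum.group[OF _ _ \<phi>_G, of "\<lambda>y. sign (Tr m (\<phi> y))"]
      sum.group[OF _ _ \<phi>_B', of "\<lambda>y. sign (Tr m (\<phi> y))"]
    by simp
  also have "\<dots> = (\<Sum>c\<in>GF m. int (card (P c)) * sign (Tr m c)) + (\<Sum>c\<in>GF m. int (card (Q c)) * sign (Tr m c))"
    by (simp add: P_def Q_def)
  also have "\<dots> = (\<Sum>c\<in>GF m. int (card (P c) + card (Q c)) * sign (Tr m c))"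
    by (simp add: sum.distrib algebra_simps)
  also have "\<dots> = (\<Sum>c\<in>GF m. 2 * sign (Tr m (c :: 'a)))"
    using two by (intro sum.cong) auto
  also have "\<dots> = 0"
    by (simp add: sum_sign_Tr_GF flip: sum_distrib_left)
  finally have cancel: "(\<Sum>y\<in>G. sign (Tr m (\<phi> y))) = - (\<Sum>y\<in>B. sign (Tr m (\<phi> y)))"
    by simp
  \<comment> \<open>The 1 is the term at \<open>x = 0\<close>, where \<open>0 ^ (q - 2) = 0\<close>
    because \<open>q > 2\<close>. On the remaining terms \<open>x ^ (q - 2)\<close> is
    \<open>1 / x\<close>, and inverting \<open>x\<close> produces \<open>\<phi>\<close>.\<close>
  have "kloosterman m A = 1 + (\<Sum>x\<in>G. sign (Tr m (A * x + x ^ (q - 2))))"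
    using sum.remove[of "GF m" "0 :: 'a" "\<lambda>x. sign (Tr m (A * x + x ^ (q - 2)))"] q_ge_4
    by (simp add: kloosterman_def G_def power_0_left flip: q_def)
  also have "(\<Sum>x\<in>G. sign (Tr m (A * x + x ^ (q - 2)))) = (\<Sum>y\<in>G. sign (Tr m (\<phi> y)))"
  proof (rule sum.reindex_bij_witness[of _ inverse inverse])
    fix x assume x: "x \<in> G"
    then have "x * x ^ (q - 2) = x ^ (q - 1)"
      using q_ge_4 by (simp add: numeral_2_eq_2 Suc_diff_Suc flip: power_Suc)
    also have "\<dots> = 1"
      using x by (auto simp: G_def mem_GF')
    finally have "x ^ (q - 2) = inverse x"
      by (metis inverse_unique)
    then show "sign (Tr m (\<phi> (inverse x))) = sign (Tr m (A * x + x ^ (q - 2)))"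
      by (simp add: \<phi>_def add.commute)
  qed (use GF_intros in \<open>auto simp: G_def\<close>)
  also note cancel
  finally show ?thesis
    by (simp add: Tr_transitive \<phi>_B)
qed

section \<open>Polar decomposition of the nonzero elements\<close>

lemma u_nonzero: "u \<noteq> 0"
  using u_power_eq_1_iff[of "q + 1"] by auto

text \<open>Exponents of \<open>u\<close> count modulo \<open>q + 1\<close>, where \<open>k\<close>
  is invertible, and \<open>0, ..., q\<close> are pairwise incongruent.\<close>

lemma u_power_mult_eqD:
  assumes "u ^ (k * i) = u ^ (k * j)" "coprime k (q + 1)" "i \<le> q" "j \<le> q"
  shows "i = j"
  using assms(1,3,4)
proof (induction i j rule: linorder_wlog)
  case (le i j)
  have "u ^ (k * j) = u ^ (k * i) * u ^ (k * (j - i))"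
    using \<open>i \<le> j\<close> by (simp flip: power_add distrib_left)
  then have "u ^ (k * (j - i)) = 1"
    using le u_nonzero by simp
  then have "(q + 1) dvd j - i"
    using u_power_eq_1_iff assms(2) by (metis coprime_commute coprime_dvd_mult_right_iff)
  then show ?case
    using le by (auto dest: dvd_imp_le)
qed auto

lemma coprime_2: "coprime 2 (q + 1)"
  using q_even by simp

lemma u_power_q_minus_1: "(u ^ i) ^ (q - 1) * u ^ (2 * i) = 1"
proof -
  have "(u ^ i) ^ (q - 1) * u ^ (2 * i) = u ^ (i * (q - 1) + 2 * i)"
    by (simp flip: power_mult power_add)
  also have "i * (q - 1) + 2 * i = (q + 1) * i"
    using q_gt_1 by (cases q) (auto simp: algebra_simps)
  finally show ?thesis
    using u_power_eq_1_iff by (metis dvd_triv_left)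
qed

text \<open>The power \<open>q - 1\<close> kills the factors from \<open>GF m\<close> and leaves
  \<open>u\<close> to the powers \<open>- 2 i\<close> and \<open>- 2 j\<close>; 2 is invertible
  modulo the odd number \<open>q + 1\<close>.\<close>

lemma u_power_mult_eq_iff:
  assumes "y \<in> GF m - {0}" "z \<in> GF m - {0}" "i \<le> q" "j \<le> q"
  shows "u ^ i * y = u ^ j * z \<longleftrightarrow> i = j \<and> y = z"
proof
  assume "u ^ i * y = u ^ j * z"
  then have "(u ^ i) ^ (q - 1) * y ^ (q - 1) = (u ^ j) ^ (q - 1) * z ^ (q - 1)"
    by (metis power_mult_distrib)
  moreover have "y ^ (q - 1) = 1" "z ^ (q - 1) = 1"
    using assms mem_GF' by blast+
  ultimately have "(u ^ i) ^ (q - 1) = (u ^ j) ^ (q - 1)"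
    by simp
  then have "u ^ (2 * i) = u ^ (2 * j)"
    using u_power_q_minus_1[of i] u_power_q_minus_1[of j] by (metis inverse_unique)
  then have "i = j"
    using u_power_mult_eqD coprime_2 assms by blast
  then show "i = j \<and> y = z"
    using \<open>u ^ i * y = u ^ j * z\<close> u_nonzero by simp
qed simp

text \<open>Surjectivity follows from injectivity by counting:
  \<open>(q + 1) * (q - 1) = q ^ 2 - 1\<close>.\<close>

lemma bij_betw_polar:
  "bij_betw (\<lambda>(i, y). u ^ i * y) ({..q} \<times> (GF m - {0})) (UNIV - {0})"
proof -
  let ?h = "\<lambda>(i, y). u ^ i * y" and ?D = "{..q} \<times> (GF m - {0 :: 'a})"
  have inj: "inj_on ?h ?D"
    using u_power_mult_eq_iff by (auto simp: inj_on_def)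
  have "card (?h ` ?D) = (q + 1) * (q - 1)"
    by (simp add: card_image[OF inj] card_GF_nonzero)
  also have "\<dots> = card (UNIV - {0 :: 'a})"
    by (simp add: card_UNIV card_Diff_singleton power2_eq_square diff_mult_distrib2)
  finally have "?h ` ?D = UNIV - {0}"
    using u_nonzero by (intro card_subset_eq) auto
  with inj show ?thesis
    by (simp add: bij_betw_def)
qed

lemma mult_u_mem_GF_iff:
  assumes "b \<noteq> 0"
  shows "b * u ^ i \<in> GF m \<longleftrightarrow> b ^ (q - 1) = u ^ (2 * i)"
proof -
  have "b * u ^ i \<in> GF m \<longleftrightarrow> b ^ (q - 1) * (u ^ i) ^ (q - 1) = 1"
    using assms u_nonzero by (simp add: mem_GF' power_mult_distrib)
  also have "\<dots> \<longleftrightarrow> b ^ (q - 1) = u ^ (2 * i)"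
    using u_power_q_minus_1[of i] u_nonzero
    by (metis (no_types) inverse_unique mult.commute)
  finally show ?thesis .
qed

lemma ex_mult_u_mem_GF:
  assumes "b \<noteq> 0"
  obtains i where "i \<le> q" "{i. i \<le> q \<and> b * u ^ i \<in> GF m} = {i}"
proof -
  have "b \<in> (\<lambda>(i, y). u ^ i * y) ` ({..q} \<times> (GF m - {0}))"
    using bij_betw_polar assms by (simp add: bij_betw_def)
  then obtain j y where j: "b = u ^ j * y" "j \<le> q" "y \<in> GF m"
    by auto
  \<comment> \<open>This is \<open>- j\<close> modulo \<open>q + 1\<close>, reduced to the range up
    to \<open>q\<close>; the plain formula would give \<open>q + 1\<close> at
    \<open>j = 0\<close>.\<close>
  define i where "i = (if j = 0 then 0 else q + 1 - j)"
  have "u ^ (j + i) = 1"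
    using j(2) by (simp add: i_def u_power_eq_1_iff)
  then have "b * u ^ i = y"
    using j(1) by (metis power_add mult.commute mult.assoc mult_1)
  then have i: "b * u ^ i \<in> GF m" "i \<le> q"
    using j(3) by (simp, auto simp: i_def)
  moreover have "k = i" if "k \<le> q" "b * u ^ k \<in> GF m" for k
    using that i u_power_mult_eqD[OF _ coprime_2] assms by (simp add: mult_u_mem_GF_iff)
  ultimately have "{k. k \<le> q \<and> b * u ^ k \<in> GF m} = {i}"
    by blast
  with i(2) show thesis
    by (rule that)
qed

section \<open>Walsh transform, bentness and dual of functions constant on the rays
  \<open>u ^ i * y\<close>\<close>

text \<open>The leading 1 comes from \<open>x = 0\<close>. Ray \<open>i\<close> contributes
  \<open>sign (g i)\<close> times a complete sum over \<open>GF m\<close> less its zero term, and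
  that complete sum is \<open>q\<close> or 0 according to whether \<open>b * u ^ i\<close> lies in
  \<open>GF m\<close>.\<close>

lemma walsh_eq:
  assumes f: "\<And>i y. i \<le> q \<Longrightarrow> y \<in> GF m - {0} \<Longrightarrow> f (u ^ i * y) = g i" and "f 0 = 0"
  shows "walsh (2 * m) f b = 1 - (\<Sum>i\<le>q. sign (g i))
    + int q * (\<Sum>i | i \<le> q \<and> b * u ^ i \<in> GF m. sign (g i))"
proof -
  let ?F = "\<lambda>x. sign (f x + Tr (2 * m) (b * x))" and ?G = "GF m - {0 :: 'a}"
  have inner: "(\<Sum>y\<in>?G. ?F (u ^ i * y))
      = sign (g i) * ((if b * u ^ i \<in> GF m then int q else 0) - 1)" if "i \<le> q" for i
  proof -
    \<comment> \<open>The relative trace of \<open>b * u ^ i\<close>; as \<open>y\<close> lies in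
      \<open>GF m\<close>, it factors out of the relative trace of
      \<open>b * u ^ i * y\<close>.\<close>
    define c where "c = b * u ^ i + (b * u ^ i) ^ q"
    have "(\<Sum>y\<in>?G. ?F (u ^ i * y)) = (\<Sum>y\<in>?G. sign (g i) * sign (Tr m (c * y)))"
    proof (rule sum.cong)
      fix y assume y: "y \<in> ?G"
      have "b * (u ^ i * y) + (b * (u ^ i * y)) ^ q = c * y"
        using y by (simp add: c_def power_mult_distrib mem_GF algebra_simps)
      then have "Tr (2 * m) (b * (u ^ i * y)) = Tr m (c * y)"
        by (simp only: Tr_transitive)
      then show "?F (u ^ i * y) = sign (g i) * sign (Tr m (c * y))"
        using f[OF that y] by (simp only: sign_add)
    qed simp
    moreover have "c \<in> GF m"
      by (simp add: c_def add_power_q_mem_GF)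
    moreover have "c = 0 \<longleftrightarrow> b * u ^ i \<in> GF m"
      by (auto simp: c_def add_eq_0_iff_eq mem_GF)
    ultimately show ?thesis
      by (simp add: sum_sign_Tr_GF_mult flip: sum_distrib_left)
  qed
  have "walsh (2 * m) f b = 1 + sum ?F (UNIV - {0})"
    unfolding walsh_def using sum.remove[of UNIV 0 ?F] assms(2) by simp
  also have "sum ?F (UNIV - {0}) = (\<Sum>(i, y)\<in>{..q} \<times> ?G. ?F (u ^ i * y))"
    using sum.reindex_bij_betw[OF bij_betw_polar, of ?F] by (simp add: case_prod_unfold)
  also have "\<dots> = (\<Sum>i\<le>q. \<Sum>y\<in>?G. ?F (u ^ i * y))"
    by (simp add: sum.cartesian_product)
  also have "\<dots> = (\<Sum>i\<le>q. sign (g i) * ((if b * u ^ i \<in> GF m then int q else 0) - 1))"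
    by (rule sum.cong) (simp_all only: inner atMost_iff)
  also have "\<dots> = int q * (\<Sum>i\<le>q. if b * u ^ i \<in> GF m then sign (g i) else 0) - (\<Sum>i\<le>q. sign (g i))"
    unfolding sum_distrib_left sum_subtractf[symmetric] by (intro sum.cong) (auto simp: algebra_simps)
  also have "(\<Sum>i\<le>q. if b * u ^ i \<in> GF m then sign (g i) else 0)
      = (\<Sum>i | i \<le> q \<and> b * u ^ i \<in> GF m. sign (g i))"
    by (subst sum.inter_filter[symmetric]) simp_all
  finally show ?thesis
    by simp
qed

lemma walsh_0_eq:
  assumes "\<And>i y. i \<le> q \<Longrightarrow> y \<in> GF m - {0} \<Longrightarrow> f (u ^ i * y) = g i" and "f 0 = 0"
  shows "walsh (2 * m) f 0 = 1 + (int q - 1) * (\<Sum>i\<le>q. sign (g i))"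
proof -
  have "{i. i \<le> q \<and> 0 * u ^ i \<in> GF m} = {..q}"
    by auto
  then show ?thesis
    using walsh_eq[of f g 0] assms by (simp add: algebra_simps)
qed

text \<open>For \<open>b \<noteq> 0\<close> exactly one ray has \<open>b * u ^ i\<close> in
  \<open>GF m\<close>, so the last sum in \<open>walsh_eq\<close> has a single term.\<close>

lemma walsh_nonzero_eq:
  assumes "\<And>i y. i \<le> q \<Longrightarrow> y \<in> GF m - {0} \<Longrightarrow> f (u ^ i * y) = g i" and "f 0 = 0"
    and b: "b \<noteq> 0" "i \<le> q" "b ^ (q - 1) = u ^ (2 * i)"
  shows "walsh (2 * m) f b = 1 - (\<Sum>i\<le>q. sign (g i)) + int q * sign (g i)"
proof -
  obtain j where j: "{i. i \<le> q \<and> b * u ^ i \<in> GF m} = {j}"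
    using ex_mult_u_mem_GF b(1) by blast
  moreover have "i \<in> {i. i \<le> q \<and> b * u ^ i \<in> GF m}"
    using b by (simp add: mult_u_mem_GF_iff)
  ultimately have "{i. i \<le> q \<and> b * u ^ i \<in> GF m} = {i}"
    by simp
  then show ?thesis
    using walsh_eq[of f g b] assms(1,2) by simp
qed

lemma ex_polar_exponent:
  assumes "b \<noteq> 0"
  obtains i where "i \<le> q" "b ^ (q - 1) = u ^ (2 * i)"
proof -
  obtain i where i: "i \<le> q" "{i. i \<le> q \<and> b * u ^ i \<in> GF m} = {i}"
    using ex_mult_u_mem_GF[OF assms] .
  then have "i \<in> {i. i \<le> q \<and> b * u ^ i \<in> GF m}"
    by simp
  with i(1) show thesis
    by (intro that) (simp_all add: mult_u_mem_GF_iff[OF assms])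
qed

lemma powr_half: "2 powr (real (2 * m) / 2) = real q"
  by (simp add: q_def powr_realpow)

text \<open>The value at 0 alone forces the sum to be 1. Conversely, a sum equal to 1 makes the
  transform \<open>q\<close> at 0 and \<open>q\<close> times a sign elsewhere.\<close>

lemma bent_iff:
  assumes f: "\<And>i y. i \<le> q \<Longrightarrow> y \<in> GF m - {0} \<Longrightarrow> f (u ^ i * y) = g i" "f 0 = 0"
  shows "bent (2 * m) f \<longleftrightarrow> (\<Sum>i\<le>q. sign (g i)) = 1"
proof
  define S where "S = (\<Sum>i\<le>q. sign (g i))"
  assume "bent (2 * m) f"
  then have "\<bar>real_of_int (walsh (2 * m) f 0)\<bar> = real q"
    by (simp only: bent_def powr_half)
  then have "\<bar>walsh (2 * m) f 0\<bar> = int q"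
    by linarith
  moreover have "walsh (2 * m) f 0 = 1 + (int q - 1) * S"
    unfolding S_def using f by (rule walsh_0_eq)
  \<comment> \<open>The values \<open>q\<close> and \<open>- q\<close> at 0 give the two cases. The
    second would require \<open>q - 1\<close> to divide 2, which \<open>q \<ge> 4\<close>
    excludes.\<close>
  ultimately consider "(int q - 1) * S = int q - 1" | "(int q - 1) * S = - int q - 1"
    by linarith
  then have "S = 1"
  proof cases
    case 2
    then have "(int q - 1) * (S + 1) = - 2"
      by (simp add: distrib_left)
    then have "int q - 1 dvd 2"
      by (metis dvd_minus_iff dvd_triv_left)
    then have "int q - 1 \<le> 2"
      by (rule zdvd_imp_le) simp
    then show ?thesis
      using q_ge_4 by simp
  qed (use q_gt_1 in simp)
  then show "(\<Sum>i\<le>q. sign (g i)) = 1"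
    by (simp add: S_def)
next
  assume S: "(\<Sum>i\<le>q. sign (g i)) = 1"
  have "\<bar>walsh (2 * m) f b\<bar> = int q" for b
  proof (cases "b = 0")
    case True
    have "walsh (2 * m) f 0 = 1 + (int q - 1) * (\<Sum>i\<le>q. sign (g i))"
      using f by (rule walsh_0_eq)
    with True S show ?thesis
      by simp
  next
    case False
    then obtain i where i: "i \<le> q" "b ^ (q - 1) = u ^ (2 * i)"
      by (rule ex_polar_exponent)
    have "walsh (2 * m) f b = 1 - (\<Sum>i\<le>q. sign (g i)) + int q * sign (g i)"
      using f False i by (rule walsh_nonzero_eq)
    with S show ?thesis
      by (simp add: abs_mult)
  qed
  then have "\<bar>real_of_int (walsh (2 * m) f b)\<bar> = real q" for b
    by (metis of_int_abs of_int_of_nat_eq)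
  then show "bent (2 * m) f"
    by (simp only: bent_def powr_half simp_thms)
qed

lemma dual_bent:
  assumes f: "\<And>i y. i \<le> q \<Longrightarrow> y \<in> GF m - {0} \<Longrightarrow> f (u ^ i * y) = g i" "f 0 = 0"
    and "bent (2 * m) f"
  shows "dual (2 * m) f 0 = 0"
    and "b \<noteq> 0 \<Longrightarrow> i \<le> q \<Longrightarrow> b ^ (q - 1) = u ^ (2 * i) \<Longrightarrow> dual (2 * m) f b = g i"
proof -
  have "bent (2 * m) f \<longleftrightarrow> (\<Sum>i\<le>q. sign (g i)) = 1"
    using f by (rule bent_iff)
  then have S: "(\<Sum>i\<le>q. sign (g i)) = 1"
    using \<open>bent (2 * m) f\<close> by simp
  have "walsh (2 * m) f 0 = 1 + (int q - 1) * (\<Sum>i\<le>q. sign (g i))"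
    using f by (rule walsh_0_eq)
  then show "dual (2 * m) f 0 = 0"
    using S by (intro dual_eqI, unfold powr_half) simp
  assume b: "b \<noteq> 0" "i \<le> q" "b ^ (q - 1) = u ^ (2 * i)"
  have "walsh (2 * m) f b = 1 - (\<Sum>i\<le>q. sign (g i)) + int q * sign (g i)"
    using f b by (rule walsh_nonzero_eq)
  then show "dual (2 * m) f b = g i"
    using S by (intro dual_eqI, unfold powr_half) simp
qed

section \<open>The values on the rays and their sum\<close>

lemma u_powi_eq_inverse: "u powi (- 2 * int i * int l) = inverse (u ^ (2 * i * l))"
  by (metis mult_minus_left of_nat_mult of_nat_numeral power_int_minus power_int_of_nat)

text \<open>The \<open>l\<close>-th power of \<open>u_power_q_minus_1\<close>; it matches the
  negative exponents of the bentness criterion with the powers occurring in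
  \<open>f\<close>.\<close>

lemma u_powi: "u powi (- 2 * int i * int l) = (u ^ i) ^ (l * (q - 1))"
proof -
  have "(u ^ i) ^ (l * (q - 1)) * u ^ (2 * i * l) = ((u ^ i) ^ (q - 1) * u ^ (2 * i)) ^ l"
    by (simp add: power_mult_distrib mult_ac flip: power_mult)
  also have "\<dots> = 1"
    by (simp only: u_power_q_minus_1 power_one)
  finally have "u ^ (2 * i * l) * (u ^ i) ^ (l * (q - 1)) = 1"
    by (simp only: mult.commute)
  then show ?thesis
    unfolding u_powi_eq_inverse by (rule inverse_unique)
qed

text \<open>As \<open>2 * l\<close> is invertible modulo \<open>q + 1\<close>, the arguments of the
  trace are \<open>q + 1\<close> distinct elements of norm \<open>a ^ (q + 1)\<close>, so they can
  serve as the set \<open>B\<close> of \<open>kloosterman_eq\<close>.\<close>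

lemma sum_sign_Tr_u:
  fixes a :: 'a
  assumes "a \<noteq> 0" "coprime l (q + 1)"
  shows "(\<Sum>i\<le>q. sign (Tr (2 * m) (a * u powi (- 2 * int i * int l)))) = 1 - kloosterman m (a ^ (q + 1))"
proof -
  define h where "h = (\<lambda>i. a * u powi (- 2 * int i * int l))"
  have h: "h i = a * inverse (u ^ (2 * l * i))" for i
    unfolding h_def u_powi_eq_inverse by (simp only: mult_ac)
  have "coprime (2 * l) (q + 1)"
    using coprime_2 assms(2) by simp
  then have inj: "inj_on h {..q}"
    using assms(1) u_power_mult_eqD by (auto simp: inj_on_def h)
  have "(u ^ k) ^ (q + 1) = 1" for k
    by (metis dvd_triv_right power_mult u_power_eq_1_iff)
  then have "y ^ (q + 1) = a ^ (q + 1)" if "y \<in> h ` {..q}" for y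
    using that by (auto simp only: h power_mult_distrib power_inverse inverse_1 mult_1_right)
  moreover have "a ^ (q + 1) \<in> GF m"
    by (simp add: mem_GF power_mult_distrib mult.commute)
  ultimately have "kloosterman m (a ^ (q + 1)) = 1 - (\<Sum>y\<in>h ` {..q}. sign (Tr (2 * m) y))"
    using assms(1) by (intro kloosterman_eq) (simp_all add: card_image[OF inj])
  then show ?thesis
    unfolding sum.reindex[OF inj] by (simp add: h_def)
qed

end

section \<open>Bentness criterion and dual for the given function\<close>

theorem theorem3p3:
  fixes m n q l\<^sub>1 l\<^sub>2 :: nat
    and \<omega> u a\<^sub>1 a\<^sub>2 :: "'a::finite_field"
    and I :: "nat set" and N :: "'a set" and f :: "'a \<Rightarrow> bit"
  assumes "m \<ge> 2" and "n = 2 * m" and "q = 2 ^ m"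
    and "CARD('a) = q ^ 2"
    and "primitive_element \<omega>"
    and "u = \<omega> ^ ((q - 1) * (2 ^ (n - 1) - 1))"
    and "a\<^sub>2 \<noteq> 0"
    and "gcd l\<^sub>2 (q + 1) = 1"
    and "I \<subseteq> {0..q - 1}"
    and "N = (\<Union>i\<in>I. (\<lambda>y. u ^ i * y) ` (GF m - {0}))"
    and "f = (\<lambda>x. if x \<in> N then Tr n (a\<^sub>1 * x ^ (l\<^sub>1 * (q - 1)))
                  else Tr n (a\<^sub>2 * x ^ (l\<^sub>2 * (q - 1))))"
  shows "(bent n f \<longleftrightarrow>
            (\<Sum>i\<in>I. sign (Tr n (a\<^sub>1 * u powi (- 2 * int i * int l\<^sub>1)))
                   - sign (Tr n (a\<^sub>2 * u powi (- 2 * int i * int l\<^sub>2))))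
            = kloosterman m (a\<^sub>2 ^ (q + 1)))
       \<and> (bent n f \<longrightarrow>
            dual n f = (\<lambda>x. if \<exists>i\<in>I. x ^ (q - 1) = u ^ (2 * i)
                            then Tr n (a\<^sub>1 * x ^ (l\<^sub>1 * (q ^ 2 - q)))
                            else Tr n (a\<^sub>2 * x ^ (l\<^sub>2 * (q ^ 2 - q)))))"
proof -
  have m_pos: "m > 0"
    using \<open>m \<ge> 2\<close> by simp
  have q: "q \<ge> 4"
    using power_increasing[OF \<open>m \<ge> 2\<close>, of "2 :: nat"] unfolding \<open>q = 2 ^ m\<close> by simp
  define K :: nat where "K = 2 ^ (n - 1) - 1"
  have "2 * K + 1 = q ^ 2 - 1"
  proof -
    have "(2 :: nat) * 2 ^ (n - 1) = 2 ^ n"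
      using \<open>n = 2 * m\<close> m_pos by (simp flip: power_Suc)
    also have "\<dots> = q ^ 2"
      using \<open>n = 2 * m\<close> \<open>q = 2 ^ m\<close> by (simp add: mult.commute flip: power_mult)
    finally have "2 * 2 ^ (n - 1) = q ^ 2" .
    moreover have "1 < q ^ 2"
      using q by (intro one_less_power) auto
    ultimately show ?thesis
      unfolding K_def by linarith
  qed
  also have q2: "q ^ 2 - 1 = (q - 1) * (q + 1)"
    by (cases q) (simp_all add: power2_eq_square)
  finally have K: "2 * K + 1 = (q - 1) * (q + 1)" .
  \<comment> \<open>A common divisor divides both \<open>2 * K\<close> and
    \<open>2 * K + 1\<close>.\<close>
  have "coprime (q + 1) K"
  proof (rule coprimeI)
    fix d assume "d dvd q + 1" "d dvd K"
    then have "d dvd 2 * K + 1" "d dvd 2 * K"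
      by (simp_all only: K dvd_mult)
    then show "is_unit d"
      by (simp only: dvd_add_right_iff)
  qed
  have u_eq_1: "u ^ k = 1 \<longleftrightarrow> (q + 1) dvd k" for k
  proof -
    \<comment> \<open>The order of \<open>\<omega>\<close> is \<open>(q - 1) * (q + 1)\<close>; the
      factor \<open>q - 1\<close> cancels, and \<open>K\<close> is coprime to
      \<open>q + 1\<close>.\<close>
    have "u ^ k = 1 \<longleftrightarrow> (q - 1) * (q + 1) dvd (q - 1) * (K * k)"
      unfolding \<open>u = _\<close> K_def[symmetric] power_mult[symmetric]
        primitive_element_power_eq_1_iff[OF \<open>primitive_element \<omega>\<close>] \<open>CARD('a) = q ^ 2\<close> q2
      by (simp only: mult.assoc)
    also have "\<dots> \<longleftrightarrow> (q + 1) dvd K * k"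
      using q by (intro dvd_times_left_cancel_iff) simp
    also have "\<dots> \<longleftrightarrow> (q + 1) dvd k"
      using \<open>coprime (q + 1) K\<close> by (rule coprime_dvd_mult_right_iff)
    finally show ?thesis .
  qed
  interpret polar_decomposition m q u
    by unfold_locales (fact assms u_eq_1)+
  define s\<^sub>1 where "s\<^sub>1 = (\<lambda>i. Tr n (a\<^sub>1 * u powi (- 2 * int i * int l\<^sub>1)))"
  define s\<^sub>2 where "s\<^sub>2 = (\<lambda>i. Tr n (a\<^sub>2 * u powi (- 2 * int i * int l\<^sub>2)))"
  \<comment> \<open>The value of \<open>f\<close> on ray \<open>i\<close>, for all
    \<open>i \<le> q\<close>; the index \<open>q\<close> is never in \<open>I\<close> and always
    takes the second branch.\<close>
  define g where "g = (\<lambda>i. if i \<in> I then s\<^sub>1 i else s\<^sub>2 i)"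
  have I: "I \<subseteq> {..q}"
    using \<open>I \<subseteq> {0..q - 1}\<close> by auto
  have l2: "coprime l\<^sub>2 (q + 1)"
    using \<open>gcd l\<^sub>2 (q + 1) = 1\<close> by (simp only: coprime_iff_gcd_eq_1)
  \<comment> \<open>Otherwise the gcd would be \<open>q + 1\<close>. A positive exponent makes both
    \<open>f\<close> and the claimed dual vanish at 0.\<close>
  then have "l\<^sub>2 \<noteq> 0"
    using q by (intro notI) simp
  have f: "f (u ^ i * y) = g i" if i: "i \<le> q" and y: "y \<in> GF m - {0}" for i y
  proof -
    have "u ^ i * y \<in> N \<longleftrightarrow> (\<exists>j\<in>I. \<exists>z\<in>GF m - {0}. u ^ i * y = u ^ j * z)"
      unfolding \<open>N = _\<close> by auto
    also have "\<dots> \<longleftrightarrow> (\<exists>j\<in>I. \<exists>z\<in>GF m - {0}. i = j \<and> y = z)"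
      using u_power_mult_eq_iff[OF y _ i] I by (intro bex_cong) auto
    finally have N: "u ^ i * y \<in> N \<longleftrightarrow> i \<in> I"
      using y by blast
    have "y ^ (q - 1) = 1"
      using y mem_GF' by blast
    then have "(u ^ i * y) ^ (l * (q - 1)) = u powi (- 2 * int i * int l)" for l
      unfolding u_powi power_mult_distrib by (metis power_mult mult.commute power_one mult_1_right)
    then show ?thesis
      unfolding \<open>f = _\<close> g_def s\<^sub>1_def s\<^sub>2_def N by simp
  qed
  have "0 \<notin> N"
    using u_nonzero unfolding \<open>N = _\<close> by auto
  then have f0: "f 0 = 0"
    using \<open>l\<^sub>2 \<noteq> 0\<close> q unfolding \<open>f = _\<close> by (simp add: power_0_left)
  have "(\<Sum>i\<le>q. sign (g i)) = (\<Sum>i\<in>{..q} - I. sign (s\<^sub>2 i)) + (\<Sum>i\<in>I. sign (s\<^sub>1 i))"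
    unfolding sum.subset_diff[OF I finite_atMost] by (simp add: g_def)
  also have "(\<Sum>i\<in>{..q} - I. sign (s\<^sub>2 i)) = (\<Sum>i\<le>q. sign (s\<^sub>2 i)) - (\<Sum>i\<in>I. sign (s\<^sub>2 i))"
    using I by (simp add: sum_diff)
  also have "(\<Sum>i\<le>q. sign (s\<^sub>2 i)) = 1 - kloosterman m (a\<^sub>2 ^ (q + 1))"
    unfolding s\<^sub>2_def \<open>n = _\<close> using \<open>a\<^sub>2 \<noteq> 0\<close> l2 by (rule sum_sign_Tr_u)
  finally have S: "(\<Sum>i\<le>q. sign (g i)) = 1 \<longleftrightarrow>
      (\<Sum>i\<in>I. sign (s\<^sub>1 i) - sign (s\<^sub>2 i)) = kloosterman m (a\<^sub>2 ^ (q + 1))"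
    by (auto simp: sum_subtractf)
  have "bent n f \<longleftrightarrow> (\<Sum>i\<le>q. sign (g i)) = 1"
    unfolding \<open>n = _\<close> using f f0 by (rule bent_iff)
  moreover have "dual n f b = (if \<exists>i\<in>I. b ^ (q - 1) = u ^ (2 * i)
      then Tr n (a\<^sub>1 * b ^ (l\<^sub>1 * (q ^ 2 - q))) else Tr n (a\<^sub>2 * b ^ (l\<^sub>2 * (q ^ 2 - q))))"
    if "bent n f" for b
  proof (cases "b = 0")
    case True
    have "dual n f 0 = 0"
      using f f0 \<open>bent n f\<close> unfolding \<open>n = _\<close> by (rule dual_bent(1))
    moreover have "q ^ 2 - q > 0"
      using q by (simp add: power2_eq_square)
    \<comment> \<open>No power of \<open>u\<close> is 0, so \<open>b = 0\<close> falls into the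
      second branch, with a positive exponent.\<close>
    ultimately show ?thesis
      using True q u_nonzero \<open>l\<^sub>2 \<noteq> 0\<close> by (simp add: power_0_left)
  next
    case False
    then obtain i where i: "i \<le> q" "b ^ (q - 1) = u ^ (2 * i)"
      by (rule ex_polar_exponent)
    have "dual n f b = g i"
      using f f0 \<open>bent n f\<close> False i unfolding \<open>n = _\<close> by (rule dual_bent(2))
    moreover have "(\<exists>j\<in>I. b ^ (q - 1) = u ^ (2 * j)) \<longleftrightarrow> i \<in> I"
      using i I u_power_mult_eqD[OF _ coprime_2 i(1)] by auto
    moreover have "b ^ (l * (q ^ 2 - q)) = u powi (- 2 * int i * int l)" for l
    proof -
      have "q ^ 2 - q = (q - 1) * q"
        by (cases q) (simp_all add: power2_eq_square)
      then have "b ^ (l * (q ^ 2 - q)) = ((b ^ (q - 1)) ^ q) ^ l"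
        by (simp add: mult_ac flip: power_mult)
      \<comment> \<open>Because \<open>q\<close> is \<open>- 1\<close> modulo \<open>q + 1\<close>,
        the power \<open>q\<close> inverts \<open>u ^ (2 * i)\<close>; both sides are this
        inverse.\<close>
      also have "(b ^ (q - 1)) ^ q = (u ^ i) ^ (q - 1)"
      proof -
        have "u ^ (2 * i) * (u ^ (2 * i)) ^ q = 1"
          by (metis u_eq_1 power_Suc power_mult Suc_eq_plus1 dvd_triv_right)
        moreover have "u ^ (2 * i) * (u ^ i) ^ (q - 1) = 1"
          using u_power_q_minus_1[of i] by (simp only: mult.commute)
        ultimately show ?thesis
          unfolding i(2) by (metis inverse_unique)
      qed
      finally show ?thesis
        unfolding u_powi by (simp only: mult_ac flip: power_mult)
    qed
    ultimately show ?thesis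
      by (simp add: g_def s\<^sub>1_def s\<^sub>2_def)
  qed
  ultimately show ?thesis
    using S unfolding s\<^sub>1_def s\<^sub>2_def by (intro conjI impI ext) simp_all
qed

end
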